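(* Let $$V_k^\star=\begin{bmatrix}X_k^\star&R_k^\star\\(R_k^\star)^T&U_k^\star\end{bmatrix},\qquad k=0,\dots,N-1$$ (with $X_k^\star\in\mathbb{R}^{n\times n}$, $R_k^\star\in\mathbb{R}^{n\times m}$, $U_k^\star\in\mathbb{R}^{m\times m}$) be a solution to $$\min_{V_k\succeq 0}\ \frac1N\sum_{k=0}^{N-1}\mathbf{Tr}\left(\begin{bmatrix}C&D\end{bmatrix}V_k\begin{bmatrix}C&D\end{bmatrix}^T\right)$$ subject to $$FV_{k+1}F^T=\begin{bmatrix}A&B\end{bmatrix}V_k\begin{bmatrix}A&B\end{bmatrix}^T+\sum_{i=1}^MA_iFV_kF^TA_i^T+I,\qquad k=0,\dots,N-2,$$ with $F=\begin{bmatrix}I_n&0\end{bmatrix}\in\mathbb{R}^{n\times(n+m)}$. Then an optimal solution to the optimal control problem $$\min_{\mu_k}\ \frac1N\sum_{k=0}^{N-1}\mathbf{E}\{z_k^Tz_k\}$$ subject to $$x_{k+1}=\Big(A+\sum_{i=1}^M\sigma_k(i)A_i\Big)x_k+Bu_k+w_k,\quad x_0=0,\quad z_k=Cx_k+Du_k,\quad u_k=\mu_k(x_0,\dots,x_k),$$ is given by $$u_k=(R_k^\star)^T(X_k^\star)^{-1}x_k.$$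
   Context: Here $N$ is a positive integer, $x_k\in\mathbb{R}^n$, $u_k\in\mathbb{R}^m$, and $A,A_1,\dots,A_M\in\mathbb{R}^{n\times n}$, $B\in\mathbb{R}^{n\times m}$, $C$, $D$ are given real matrices of compatible sizes with $\begin{bmatrix}C&D\end{bmatrix}^T\begin{bmatrix}C&D\end{bmatrix}\succ0$. The sequences $\{w_k\}$ (with values in $\mathbb{R}^n$) and $\{\sigma_k(i)\}$ (real-valued, $i=1,\dots,M$) are independent zero-mean white noises with arbitrary probability distributions, satisfying $\mathbf{E}\{\sigma_k(i)w_\ell\}=0$ for all $i,k,\ell$, $\mathbf{E}\{w_kw_\ell^T\}=\delta(k-\ell)I$ and $\mathbf{E}\{\sigma_k(i)\sigma_\ell(i')\}=\delta(i-i')\delta(k-\ell)$, where $\delta(0)=1$ and $\delta(k)=0$ for $k\ne0$. The minimization is over causal state-feedback controllers $\mu_k$, linear or nonlinear. $S\succeq0$ ($S\succ0$) means that $S$ is symmetric positive semidefinite (definite); $\mathbf{Tr}$ is the trace; $\mathbf{E}$ is expectation; $I$ and $I_n$ denote the $n\times n$ identity matrix. *)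

theory Defs
  imports "HOL-Probability.Probability"
begin

definition pos_semidef :: "real^'n^'n \<Rightarrow> bool" where
  "pos_semidef S \<longleftrightarrow> transpose S = S \<and> (\<forall>v. 0 \<le> v \<bullet> (S *v v))"

definition pos_def :: "real^'n^'n \<Rightarrow> bool" where
  "pos_def S \<longleftrightarrow> transpose S = S \<and> (\<forall>v. v \<noteq> 0 \<longrightarrow> 0 < v \<bullet> (S *v v))"

definition hcat :: "real^'n^'p \<Rightarrow> real^'m^'p \<Rightarrow> real^('n + 'm)^'p" where
  "hcat P Q = (\<chi> i j. case j of Inl a \<Rightarrow> P $ i $ a | Inr b \<Rightarrow> Q $ i $ b)"

definition vcat :: "real^'q^'n \<Rightarrow> real^'q^'m \<Rightarrow> real^'q^('n + 'm)" where
  "vcat P Q = (\<chi> i. case i of Inl a \<Rightarrow> P $ a | Inr b \<Rightarrow> Q $ b)"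


section \<open>The semidefinite program\<close>

definition F :: "real^('n::finite + 'm::finite)^'n" where
  "F = hcat (mat 1) 0"

definition sdp_feasible ::
  "nat \<Rightarrow> nat \<Rightarrow> real^'n^'n \<Rightarrow> (nat \<Rightarrow> real^'n^'n) \<Rightarrow> real^'m^'n \<Rightarrow>
   (nat \<Rightarrow> real^('n + 'm)^('n + 'm)) \<Rightarrow> bool" where
  "sdp_feasible N M A As B V \<longleftrightarrow>
     (\<forall>k<N. pos_semidef (V k)) \<and>
     (\<forall>k. k + 1 < N \<longrightarrow>
        F ** V (k + 1) ** transpose F =
          hcat A B ** V k ** transpose (hcat A B)
          + (\<Sum>i\<in>{1..M}. As i ** F ** V k ** transpose F ** transpose (As i)) + mat 1)"

definition sdp_cost ::
  "nat \<Rightarrow> real^'n^'p \<Rightarrow> real^'m^'p \<Rightarrow> (nat \<Rightarrow> real^('n + 'm)^('n + 'm)) \<Rightarrow> real" where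
  "sdp_cost N C D V = 1 / real N * (\<Sum>k<N. trace (hcat C D ** V k ** transpose (hcat C D)))"


section \<open>The stochastic control problem\<close>

text \<open>
  A controller \<open>\<mu>\<close> maps the time \<open>k\<close> and the state history \<open>(x\<^sub>0, \<dots>, x\<^sub>k)\<close>, encoded as an
  extensional function on \<open>{..k}\<close>, to the input at time \<open>k\<close>.
\<close>

type_synonym ('n, 'm) controller = "nat \<Rightarrow> (nat \<Rightarrow> real^'n) \<Rightarrow> real^'m"

definition causal :: "nat \<Rightarrow> ('n::finite, 'm::finite) controller \<Rightarrow> bool" where
  "causal N \<mu> \<longleftrightarrow> (\<forall>k<N. \<mu> k \<in> borel_measurable (\<Pi>\<^sub>M j\<in>{..k}. borel))"

text \<open>Needed for the termination proof of the closed-loop recursion below.\<close>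

lemma restrict_atMost_cong [fundef_cong]:
  "k = l \<Longrightarrow> (\<And>j. j \<le> l \<Longrightarrow> f j = g j) \<Longrightarrow> restrict f {..k} = restrict g {..l::nat}"
  by (auto simp: restrict_def)

fun state ::
  "nat \<Rightarrow> real^'n^'n \<Rightarrow> (nat \<Rightarrow> real^'n^'n) \<Rightarrow> real^'m^'n \<Rightarrow>
   (nat \<Rightarrow> 'a \<Rightarrow> real^'n) \<Rightarrow> (nat \<Rightarrow> nat \<Rightarrow> 'a \<Rightarrow> real) \<Rightarrow>
   ('n::finite, 'm::finite) controller \<Rightarrow> 'a \<Rightarrow> nat \<Rightarrow> real^'n" where
  "state M A As B w \<sigma> \<mu> \<omega> 0 = 0"
| "state M A As B w \<sigma> \<mu> \<omega> (Suc k) =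
     (A + (\<Sum>i\<in>{1..M}. \<sigma> k i \<omega> *\<^sub>R As i)) *v state M A As B w \<sigma> \<mu> \<omega> k
     + B *v \<mu> k (restrict (\<lambda>j. state M A As B w \<sigma> \<mu> \<omega> j) {..k})
     + w k \<omega>"

definition input ::
  "nat \<Rightarrow> real^'n^'n \<Rightarrow> (nat \<Rightarrow> real^'n^'n) \<Rightarrow> real^'m^'n \<Rightarrow>
   (nat \<Rightarrow> 'a \<Rightarrow> real^'n) \<Rightarrow> (nat \<Rightarrow> nat \<Rightarrow> 'a \<Rightarrow> real) \<Rightarrow>
   ('n::finite, 'm::finite) controller \<Rightarrow> 'a \<Rightarrow> nat \<Rightarrow> real^'m" where
  "input M A As B w \<sigma> \<mu> \<omega> k = \<mu> k (restrict (state M A As B w \<sigma> \<mu> \<omega>) {..k})"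

definition perf_output ::
  "nat \<Rightarrow> real^'n^'n \<Rightarrow> (nat \<Rightarrow> real^'n^'n) \<Rightarrow> real^'m^'n \<Rightarrow> real^'n^'p \<Rightarrow> real^'m^'p \<Rightarrow>
   (nat \<Rightarrow> 'a \<Rightarrow> real^'n) \<Rightarrow> (nat \<Rightarrow> nat \<Rightarrow> 'a \<Rightarrow> real) \<Rightarrow>
   ('n::finite, 'm::finite) controller \<Rightarrow> 'a \<Rightarrow> nat \<Rightarrow> real^'p" where
  "perf_output M A As B C D w \<sigma> \<mu> \<omega> k =
     C *v state M A As B w \<sigma> \<mu> \<omega> k + D *v input M A As B w \<sigma> \<mu> \<omega> k"

text \<open>
  The expectation of the nonnegative \<open>z\<^sub>k\<^sup>T z\<^sub>k\<close> is taken in the extended nonnegative reals: a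
  controller with infinite cost must not be assigned the Bochner integral's default value \<open>0\<close>.
\<close>

definition control_cost ::
  "'a measure \<Rightarrow> nat \<Rightarrow> nat \<Rightarrow> real^'n^'n \<Rightarrow> (nat \<Rightarrow> real^'n^'n) \<Rightarrow> real^'m^'n \<Rightarrow>
   real^'n^'p \<Rightarrow> real^'m^'p \<Rightarrow> (nat \<Rightarrow> 'a \<Rightarrow> real^'n) \<Rightarrow> (nat \<Rightarrow> nat \<Rightarrow> 'a \<Rightarrow> real) \<Rightarrow>
   ('n::finite, 'm::finite) controller \<Rightarrow> ennreal" where
  "control_cost P N M A As B C D w \<sigma> \<mu> =
     ennreal (1 / real N) *
     (\<Sum>k<N. \<integral>\<^sup>+ \<omega>. ennreal (perf_output M A As B C D w \<sigma> \<mu> \<omega> k \<bullet>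
                             perf_output M A As B C D w \<sigma> \<mu> \<omega> k) \<partial>P)"

text \<open>
  At time \<open>0\<close> a solution of the semidefinite program may have (and in fact has) a singular block
  \<open>X\<^sub>0\<close>, for which \<^const>\<open>matrix_inv\<close> is an unspecified matrix.  This is harmless since
  \<open>x\<^sub>0 = 0\<close>; for \<open>k \<ge> 1\<close> the constraints make \<open>X\<^sub>k\<close> positive definite.
\<close>

definition sdp_controller ::
  "(nat \<Rightarrow> real^'n^'n) \<Rightarrow> (nat \<Rightarrow> real^'m^'n) \<Rightarrow> ('n::finite, 'm::finite) controller" where
  "sdp_controller X R = (\<lambda>k h. (transpose (R k) ** matrix_inv (X k)) *v h k)"

text \<open>
  The noise: zero mean, the given second moments, and whiteness in the sense that the joint noise
  vectors \<open>(w\<^sub>k, \<sigma>\<^sub>k(1), \<dots>, \<sigma>\<^sub>k(M))\<close> at different times are independent.  This is implied by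
  mutual independence of all the variables \<open>w\<^sub>k\<close> and \<open>\<sigma>\<^sub>k(i)\<close>; at equal times only uncorrelatedness
  is required.  Integrability of the products of noise variables follows from the nonzero second
  moments, so no Bochner integral below takes its default value for lack of integrability.
\<close>

definition white_noises ::
  "'a measure \<Rightarrow> nat \<Rightarrow> (nat \<Rightarrow> 'a \<Rightarrow> real^'n::finite) \<Rightarrow> (nat \<Rightarrow> nat \<Rightarrow> 'a \<Rightarrow> real) \<Rightarrow> bool" where
  "white_noises P M w \<sigma> \<longleftrightarrow>
     prob_space.indep_vars P (\<lambda>_. borel \<Otimes>\<^sub>M (\<Pi>\<^sub>M i\<in>{1..M}. borel))
       (\<lambda>k \<omega>. (w k \<omega>, \<lambda>i\<in>{1..M}. \<sigma> k i \<omega>)) UNIV \<and>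
     (\<forall>k. prob_space.expectation P (w k) = 0) \<and>
     (\<forall>k. \<forall>i\<in>{1..M}. prob_space.expectation P (\<sigma> k i) = 0) \<and>
     (\<forall>k l. \<forall>i\<in>{1..M}. prob_space.expectation P (\<lambda>\<omega>. \<sigma> k i \<omega> *\<^sub>R w l \<omega>) = 0) \<and>
     (\<forall>k l. prob_space.expectation P 
        (\<lambda>\<omega>. (columnvector (w k \<omega>) :: real^1^'n) ** rowvector (w l \<omega>)) =
        (if k = l then mat 1 else 0)) \<and>
     (\<forall>k l. \<forall>i\<in>{1..M}. \<forall>j\<in>{1..M}. prob_space.expectation P (\<lambda>\<omega>. \<sigma> k i \<omega> * \<sigma> l j \<omega>) =
        (if i = j \<and> k = l then 1 else 0))"

end

theory Submission
  imports Defs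
begin

text \<open>
  For a causal controller of finite cost, the second moments of \<open>(x\<^sub>k, u\<^sub>k)\<close> are feasible for the
  semidefinite program with the same cost: the noise at time \<open>k\<close> is independent of \<open>(x\<^sub>k, u\<^sub>k)\<close>, so
  all cross terms vanish in the second moment of \<open>x\<^sub>k\<^sub>+\<^sub>1\<close>.  Hence the optimal value of the program
  bounds the control cost from below.  Conversely, under \<open>u\<^sub>k = R\<^sub>k\<^sup>T X\<^sub>k\<^sup>-\<^sup>1 x\<^sub>k\<close> the second moments
  \<open>V'\<^sub>k\<close> satisfy \<open>V'\<^sub>k \<le> V\<^sub>k\<close> in the Loewner order, by induction on \<open>k\<close> from \<open>V'\<^sub>0 = 0\<close>: if \<open>V'\<^sub>k \<le> V\<^sub>k\<close> then the second
  moment of \<open>x\<^sub>k\<^sub>+\<^sub>1\<close> is at most \<open>X\<^sub>k\<^sub>+\<^sub>1\<close> by monotonicity of the constraint, and the Schur complement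
  inequality passes from \<open>X\<^sub>k\<^sub>+\<^sub>1\<close> to \<open>V\<^sub>k\<^sub>+\<^sub>1\<close>.  So this controller attains the lower bound.
\<close>

section \<open>Block vectors and quadratic forms\<close>

definition block_vec :: "real^'n \<Rightarrow> real^'m \<Rightarrow> real^('n + 'm)" where
  "block_vec a b = (\<chi> i. case i of Inl j \<Rightarrow> a $ j | Inr j \<Rightarrow> b $ j)"

lemma sum_UNIV_Plus:
  fixes f :: "'n::finite + 'm::finite \<Rightarrow> 'b::comm_monoid_add"
  shows "sum f UNIV = (\<Sum>i\<in>UNIV. f (Inl i)) + (\<Sum>i\<in>UNIV. f (Inr i))"
  by (subst UNIV_Plus_UNIV [symmetric], subst sum.Plus) simp_all

lemma block_vec_cases: obtains a b where "v = block_vec a b"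
proof
  show "v = block_vec (\<chi> j. v $ Inl j) (\<chi> j. v $ Inr j)"
    by (auto simp: block_vec_def vec_eq_iff split: sum.split)
qed

lemma inner_block_vec: "block_vec a b \<bullet> block_vec c d = a \<bullet> c + b \<bullet> d"
  by (simp add: block_vec_def inner_vec_def sum_UNIV_Plus)

lemma hcat_mult_block_vec: "hcat G H *v block_vec a b = G *v a + H *v b"
  by (simp add: hcat_def block_vec_def matrix_vector_mult_def vec_eq_iff sum_UNIV_Plus)

lemma vcat_mult_vec: "vcat G H *v v = block_vec (G *v v) (H *v v)"
  by (auto simp: vcat_def block_vec_def matrix_vector_mult_def vec_eq_iff split: sum.split)

lemma F_mult_block_vec: "F *v block_vec a b = a"
  by (simp add: F_def hcat_mult_block_vec)

lemma transpose_vcat_mult_block_vec: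
  fixes G :: "real^'k^'n" and H :: "real^'k^'m"
  shows "transpose (vcat G H) *v block_vec a b = transpose G *v a + transpose H *v b"
  unfolding matrix_vector_mult_def transpose_def vcat_def block_vec_def
  by (simp add: vec_eq_iff sum_UNIV_Plus)

lemma F_block_congruence:
  fixes G :: "real^'n^'n" and H :: "real^'m^'n" and K :: "real^'n^'m" and W :: "real^'m^'m"
  shows "F ** vcat (hcat G H) (hcat K W) ** transpose F = G"
proof -
  \<comment> \<open>\<open>transpose F\<close> embeds a state as \<open>(a, 0)\<close>, so the
    congruence by \<open>F\<close> reads off the upper left block.\<close>
  have "transpose F *v a = (block_vec a 0 :: real^('n + 'm))" for a
    unfolding matrix_vector_mult_def transpose_def F_def hcat_def block_vec_def
    by (auto simp: vec_eq_iff mat_def if_distrib if_distribR cong: if_cong split: sum.split)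
  then show ?thesis
    by (simp add: matrix_eq F_mult_block_vec vcat_mult_vec hcat_mult_block_vec
        del: transpose_matrix_vector flip: matrix_vector_mul_assoc)
qed

text \<open>Loewner inequalities are expressed throughout as inequalities of quadratic forms. Moving
  the outer factors onto the vector shows that congruences preserve them.\<close>

lemma inner_congruence:
  fixes H :: "real^'k^'n" and S :: "real^'k^'k"
  shows "v \<bullet> ((H ** S ** transpose H) *v v) = (transpose H *v v) \<bullet> (S *v (transpose H *v v))"
  by (metis dot_lmul_matrix matrix_vector_mul_assoc transpose_matrix_vector)

lemma sum_matrix_vector_mult:
  fixes G :: "'j \<Rightarrow> real^'n^'p"
  shows "sum G J *v v = (\<Sum>j\<in>J. G j *v v)"
  by (induction J rule: infinite_finite_induct) (simp_all add: matrix_vector_mult_add_rdistrib)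

lemma trace_eq_sum_inner:
  fixes S :: "real^'p^'p"
  shows "trace S = (\<Sum>i\<in>UNIV. axis i 1 \<bullet> (S *v axis i 1))"
  by (simp add: trace_def matrix_vector_mult_basis inner_axis' column_def)

text \<open>The trace is the sum of the quadratic form over the standard basis, so a Loewner bound
  on the moment matrices becomes a bound on each stage cost.\<close>

lemma trace_congruence_mono:
  fixes H :: "real^'k^'p" and S T :: "real^'k^'k"
  assumes "\<And>v. v \<bullet> (S *v v) \<le> v \<bullet> (T *v v)"
  shows "trace (H ** S ** transpose H) \<le> trace (H ** T ** transpose H)"
  unfolding trace_eq_sum_inner inner_congruence by (intro sum_mono assms)

lemma matrix_inv_right_pos:
  fixes S :: "real^'n^'n"
  assumes "\<And>v. v \<noteq> 0 \<Longrightarrow> 0 < v \<bullet> (S *v v)"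
  shows "S ** matrix_inv S = mat 1"
proof -
  have "S *v v = 0 \<Longrightarrow> v = 0" for v
    using assms [of v] by force
  then have "invertible S"
    by (metis invertible_left_inverse matrix_left_invertible_ker)
  then show ?thesis
    unfolding invertible_def matrix_inv_def by (metis (mono_tags, lifting) someI_ex)
qed

text \<open>
  Schur complement: for given blocks \<open>G\<close> and \<open>H\<close>, the smallest positive semidefinite completion is
  the one generated by the gain \<open>H\<^sup>T G\<^sup>-\<^sup>1\<close>.
\<close>

lemma schur_gain_le:
  fixes G :: "real^'n^'n" and H :: "real^'m^'n" and W :: "real^'m^'m"
  assumes psd: "pos_semidef (vcat (hcat G H) (hcat (transpose H) W))"
    and pos: "\<And>v. v \<noteq> 0 \<Longrightarrow> 0 < v \<bullet> (G *v v)"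
    and sym: "transpose G = G"
  shows "(a + transpose (transpose H ** matrix_inv G) *v b) \<bullet>
           (G *v (a + transpose (transpose H ** matrix_inv G) *v b))
         \<le> block_vec a b \<bullet> (vcat (hcat G H) (hcat (transpose H) W) *v block_vec a b)"
proof -
  let ?V = "vcat (hcat G H) (hcat (transpose H) W)"
  define t where "t = transpose (transpose H ** matrix_inv G) *v b"
  have inv: "G ** matrix_inv G = mat 1"
    by (rule matrix_inv_right_pos) (rule pos)
  \<comment> \<open>The gain enters transposed, so \<open>transpose (matrix_inv G)\<close> must also
    be an inverse of \<open>G\<close>; this follows by transposing \<open>inv\<close> and using
    symmetry.\<close>
  have "transpose (matrix_inv G) ** G = mat 1"
    using arg_cong [OF inv, of transpose] by (simp add: matrix_transpose_mul sym transpose_mat)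
  then have "G ** transpose (matrix_inv G) = mat 1"
    by (simp add: matrix_left_right_inverse)
  then have "(G ** transpose (matrix_inv G)) *v (H *v b) = H *v b"
    by simp
  then have Gt: "G *v t = H *v b"
    unfolding t_def matrix_transpose_mul transpose_transpose
    by (simp only: matrix_vector_mul_assoc matrix_mul_assoc)
  have V: "?V *v block_vec c d = block_vec (G *v c + H *v d) (transpose H *v c + W *v d)" for c d
    by (simp only: vcat_mult_vec hcat_mult_block_vec)
  have Gsym: "c \<bullet> (G *v d) = d \<bullet> (G *v c)" for c d
    by (metis dot_lmul_matrix inner_commute sym transpose_matrix_vector)
  have H: "b \<bullet> (transpose H *v c) = c \<bullet> (H *v b)" for c
    by (metis dot_lmul_matrix inner_commute transpose_matrix_vector)
  \<comment> \<open>Since \<open>G *v t = H *v b\<close>, the first component \<open>- t\<close>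
    minimizes the block form for fixed \<open>b\<close>. Its value there is the Schur complement
    form \<open>b \<bullet> (W *v b) - t \<bullet> (G *v t)\<close>, exactly the gap between the two
    sides of the claim.\<close>
  have "0 \<le> block_vec (- t) b \<bullet> (?V *v block_vec (- t) b)"
    using psd by (simp add: pos_semidef_def)
  then have "0 \<le> b \<bullet> (W *v b) - t \<bullet> (G *v t)"
    unfolding V inner_block_vec inner_add_right H Gt [symmetric]
    by (simp add: linear_neg [OF matrix_vector_mul_linear])
  moreover have "block_vec a b \<bullet> (?V *v block_vec a b) =
      a \<bullet> (G *v a) + 2 * (a \<bullet> (G *v t)) + b \<bullet> (W *v b)"
    unfolding V inner_block_vec inner_add_right H Gt [symmetric] by simp
  moreover have "(a + t) \<bullet> (G *v (a + t)) = a \<bullet> (G *v a) + 2 * (a \<bullet> (G *v t)) + t \<bullet> (G *v t)"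
    by (simp add: matrix_vector_right_distrib inner_add_left inner_add_right Gsym [of t a])
  ultimately show ?thesis
    by (simp only: t_def [symmetric])
qed

section \<open>Square integrable random vectors\<close>

definition square_integrable :: "'a measure \<Rightarrow> ('a \<Rightarrow> 'b::euclidean_space) \<Rightarrow> bool" where
  "square_integrable P f \<longleftrightarrow> f \<in> borel_measurable P \<and> integrable P (\<lambda>\<omega>. (norm (f \<omega>))\<^sup>2)"

text \<open>This is the matrix E[f f^T], taken entrywise so that facts about scalar integrals apply;
  the entries exist once \<open>f\<close> is square integrable.\<close>

definition second_moment :: "'a measure \<Rightarrow> ('a \<Rightarrow> real^'n) \<Rightarrow> real^'n^'n" where
  "second_moment P f = (\<chi> i j. \<integral>\<omega>. f \<omega> $ i * f \<omega> $ j \<partial>P)"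

lemma square_integrable_measurable: "square_integrable P f \<Longrightarrow> f \<in> borel_measurable P"
  by (simp add: square_integrable_def)

lemma square_integrable_linear:
  assumes "square_integrable P f" "bounded_linear h"
  shows "square_integrable P (\<lambda>\<omega>. h (f \<omega>))"
proof -
  obtain K where K: "\<And>x. norm (h x) \<le> norm x * K"
    using bounded_linear.bounded [OF assms(2)] by blast
  have [measurable]: "f \<in> borel_measurable P" "h \<in> borel_measurable borel"
    using assms linear_continuous_on borel_measurable_continuous_onI
    by (auto simp: square_integrable_def)
  have "integrable P (\<lambda>\<omega>. K\<^sup>2 * (norm (f \<omega>))\<^sup>2)"
    using assms by (simp add: square_integrable_def)
  moreover have "(norm (h (f \<omega>)))\<^sup>2 \<le> K\<^sup>2 * (norm (f \<omega>))\<^sup>2" for \<omega>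
    using power_mono [OF K [of "f \<omega>"] norm_ge_zero, of 2] by (simp add: power_mult_distrib mult.commute)
  ultimately have "integrable P (\<lambda>\<omega>. (norm (h (f \<omega>)))\<^sup>2)"
    by (elim Bochner_Integration.integrable_bound) auto
  then show ?thesis
    by (simp add: square_integrable_def)
qed

text \<open>Domination by \<open>2 |f| |g| \<le> |f|^2 + |g|^2\<close>. All integrability of
  products of two square integrable factors rests on this.\<close>

lemma square_integrable_scaleR:
  fixes f :: "'a \<Rightarrow> real" and g :: "'a \<Rightarrow> 'b::euclidean_space"
  assumes "square_integrable P f" "square_integrable P g"
  shows "integrable P (\<lambda>\<omega>. f \<omega> *\<^sub>R g \<omega>)"
proof (rule Bochner_Integration.integrable_bound)
  show "integrable P (\<lambda>\<omega>. (norm (f \<omega>))\<^sup>2 + (norm (g \<omega>))\<^sup>2)"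
    using assms unfolding square_integrable_def by (intro Bochner_Integration.integrable_add) auto
  show "(\<lambda>\<omega>. f \<omega> *\<^sub>R g \<omega>) \<in> borel_measurable P"
    by (intro borel_measurable_scaleR square_integrable_measurable assms)
  have "norm (f \<omega> *\<^sub>R g \<omega>) \<le> (norm (f \<omega>))\<^sup>2 + (norm (g \<omega>))\<^sup>2" for \<omega>
  proof -
    have "0 \<le> \<bar>f \<omega>\<bar> * norm (g \<omega>)"
      by simp
    then show ?thesis
      using sum_squares_bound [of "\<bar>f \<omega>\<bar>" "norm (g \<omega>)"] unfolding norm_scaleR real_norm_def by linarith
  qed
  then show "AE \<omega> in P. norm (f \<omega> *\<^sub>R g \<omega>) \<le> norm ((norm (f \<omega>))\<^sup>2 + (norm (g \<omega>))\<^sup>2)"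
    by simp
qed

lemma square_integrable_product:
  fixes f g :: "'a \<Rightarrow> real"
  assumes "square_integrable P f" "square_integrable P g"
  shows "integrable P (\<lambda>\<omega>. f \<omega> * g \<omega>)"
  using square_integrable_scaleR [OF assms] by simp

lemma square_integrable_component:
  fixes f :: "'a \<Rightarrow> real^'n"
  shows "square_integrable P f \<Longrightarrow> square_integrable P (\<lambda>\<omega>. f \<omega> $ i)"
  by (rule square_integrable_linear) (auto intro: bounded_linear_vec_nth)

lemma square_integrable_matrix_mult:
  fixes H :: "real^'n^'m"
  shows "square_integrable P f \<Longrightarrow> square_integrable P (\<lambda>\<omega>. H *v f \<omega>)"
  by (rule square_integrable_linear) auto

lemma square_integrable_componentwise:
  fixes f :: "'a \<Rightarrow> real^'n"
  assumes "\<And>i. square_integrable P (\<lambda>\<omega>. f \<omega> $ i)"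
  shows "square_integrable P f"
proof -
  have "(\<lambda>\<omega>. f \<omega> \<bullet> b) \<in> borel_measurable P" if "b \<in> Basis" for b
    using that assms by (auto simp: Basis_vec_def inner_axis square_integrable_def)
  then have "f \<in> borel_measurable P"
    using borel_measurable_euclidean_space by blast
  then show ?thesis
    using assms unfolding square_integrable_def
    by (simp add: power2_norm_eq_inner inner_vec_def flip: power2_eq_square)
qed

lemma block_vec_measurable [measurable]:
  assumes [measurable]: "f \<in> borel_measurable P" "g \<in> borel_measurable P"
  shows "(\<lambda>\<omega>. block_vec (f \<omega>) (g \<omega>)) \<in> borel_measurable P"
proof -
  \<comment> \<open>A finite combination of constant unit vectors with measurable coefficients is
    visibly measurable.\<close>
  have *: "block_vec a b = (\<Sum>i\<in>UNIV. (a $ i) *\<^sub>R axis (Inl i) 1) + (\<Sum>i\<in>UNIV. (b $ i) *\<^sub>R axis (Inr i) 1)"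
    for a :: "real^'b" and b :: "real^'c"
    by (auto simp: block_vec_def vec_eq_iff axis_def if_distrib sum.If_cases cong: if_cong split: sum.split)
  have [measurable]: "(\<lambda>x::real^'d. x $ i) \<in> borel_measurable borel" for i
    by (intro borel_measurable_continuous_onI continuous_intros)
  show ?thesis
    unfolding * by measurable
qed

text \<open>Linearity of the integral over a finite double sum. It lets state, output and input
  moments all be read as congruences of one joint moment matrix.\<close>

lemma second_moment_congruence:
  fixes f :: "'a \<Rightarrow> real^'k" and H :: "real^'k^'n"
  assumes "square_integrable P f"
  shows "H ** second_moment P f ** transpose H = second_moment P (\<lambda>\<omega>. H *v f \<omega>)"
proof -
  have *: "integrable P (\<lambda>\<omega>. f \<omega> $ k * f \<omega> $ l)" for k l
    by (intro square_integrable_product square_integrable_component assms)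
  have "(\<integral>\<omega>. (H *v f \<omega>) $ i * (H *v f \<omega>) $ j \<partial>P) = (H ** second_moment P f ** transpose H) $ i $ j" for i j
  proof -
    have "(\<integral>\<omega>. (H *v f \<omega>) $ i * (H *v f \<omega>) $ j \<partial>P) =
        (\<integral>\<omega>. (\<Sum>l\<in>UNIV. \<Sum>k\<in>UNIV. H $ i $ k * H $ j $ l * (f \<omega> $ k * f \<omega> $ l)) \<partial>P)"
      by (intro Bochner_Integration.integral_cong refl)
         (simp add: matrix_vector_mult_def sum_product, subst sum.swap, simp add: ac_simps)
    also have "\<dots> = (\<Sum>l\<in>UNIV. \<Sum>k\<in>UNIV. H $ i $ k * H $ j $ l * (\<integral>\<omega>. f \<omega> $ k * f \<omega> $ l \<partial>P))"
      using * by (simp add: Bochner_Integration.integral_sum)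
    also have "\<dots> = (H ** second_moment P f ** transpose H) $ i $ j"
      by (simp add: matrix_matrix_mult_def second_moment_def transpose_def sum_distrib_left ac_simps)
    finally show ?thesis .
  qed
  then show ?thesis
    by (simp add: vec_eq_iff second_moment_def [of _ "\<lambda>\<omega>. H *v f \<omega>"])
qed

lemma transpose_second_moment: "transpose (second_moment P f) = second_moment P f"
  by (simp add: transpose_def second_moment_def vec_eq_iff mult.commute)

lemma trace_second_moment:
  assumes "square_integrable P f"
  shows "trace (second_moment P f) = (\<integral>\<omega>. f \<omega> \<bullet> f \<omega> \<partial>P)"
  unfolding trace_def second_moment_def inner_vec_def
  by (subst Bochner_Integration.integral_sum)
     (simp_all add: square_integrable_product square_integrable_component assms)

lemma inner_second_moment:
  assumes "square_integrable P f"
  shows "v \<bullet> (second_moment P f *v v) = (\<integral>\<omega>. (f \<omega> \<bullet> v)\<^sup>2 \<partial>P)"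
proof -
  \<comment> \<open>The scalar \<open>f \<omega> \<bullet> v\<close> is treated as a vector of
    dimension one, so that its second moment is the congruence by the row \<open>v\<close>.\<close>
  have "(\<integral>\<omega>. (f \<omega> \<bullet> v)\<^sup>2 \<partial>P) = trace (second_moment P (\<lambda>\<omega>. (rowvector v :: real^_^1) *v f \<omega>))"
    by (simp add: trace_def second_moment_def rowvector_def matrix_vector_mult_def inner_vec_def
        power2_eq_square mult.commute)
  also have "\<dots> = trace ((rowvector v :: real^_^1) ** second_moment P f ** transpose (rowvector v))"
    by (simp add: second_moment_congruence assms)
  also have "\<dots> = v \<bullet> (second_moment P f *v v)"
    unfolding trace_eq_sum_inner inner_congruence
    by (simp add: matrix_vector_mult_basis column_def transpose_def rowvector_def)
  finally show ?thesis ..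
qed

lemma pos_semidef_second_moment:
  assumes "square_integrable P f"
  shows "pos_semidef (second_moment P f)"
  by (simp add: pos_semidef_def transpose_second_moment inner_second_moment [OF assms])

text \<open>Expanding a product of two components gives terms \<open>(q i q j) (s i s j)\<close>.
  Independence factors each expectation, and orthonormality of the \<open>s j\<close> removes the
  terms with \<open>i \<noteq> j\<close>. The hypothesis \<open>indep\<close> concerns products
  because these are what the expansion produces.\<close>

lemma (in prob_space) second_moment_orthonormal_combination:
  fixes s :: "'j \<Rightarrow> 'a \<Rightarrow> real" and q :: "'j \<Rightarrow> 'a \<Rightarrow> real^'n"
  assumes J: "finite J"
    and s: "\<And>j. j \<in> J \<Longrightarrow> square_integrable M (s j)"
    and orth: "\<And>i j. i \<in> J \<Longrightarrow> j \<in> J \<Longrightarrow> expectation (\<lambda>\<omega>. s i \<omega> * s j \<omega>) = (if i = j then 1 else 0)"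
    and q: "\<And>j. j \<in> J \<Longrightarrow> square_integrable M (q j)"
    and indep: "\<And>i j a b. i \<in> J \<Longrightarrow> j \<in> J \<Longrightarrow>
      indep_var borel (\<lambda>\<omega>. q i \<omega> $ a * q j \<omega> $ b) borel (\<lambda>\<omega>. s i \<omega> * s j \<omega>)"
  shows "square_integrable M (\<lambda>\<omega>. \<Sum>j\<in>J. s j \<omega> *\<^sub>R q j \<omega>)"
    and "second_moment M (\<lambda>\<omega>. \<Sum>j\<in>J. s j \<omega> *\<^sub>R q j \<omega>) = (\<Sum>j\<in>J. second_moment M (q j))"
proof -
  let ?x = "\<lambda>\<omega>. \<Sum>j\<in>J. s j \<omega> *\<^sub>R q j \<omega>"
  have expand: "?x \<omega> $ a * ?x \<omega> $ b =
      (\<Sum>i\<in>J. \<Sum>j\<in>J. (q i \<omega> $ a * q j \<omega> $ b) * (s i \<omega> * s j \<omega>))" for \<omega> a b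
    by (simp add: sum_product ac_simps)
  have qq: "integrable M (\<lambda>\<omega>. q i \<omega> $ a * q j \<omega> $ b)" if "i \<in> J" "j \<in> J" for i j a b
    by (intro square_integrable_product square_integrable_component q that)
  have ss: "integrable M (\<lambda>\<omega>. s i \<omega> * s j \<omega>)" if "i \<in> J" "j \<in> J" for i j
    by (intro square_integrable_product s that)
  \<comment> \<open>A product of four square integrable factors need not be integrable. Here it is,
    because it splits into two independent integrable factors.\<close>
  note int = indep_var_integrable [OF indep qq ss]
  have "square_integrable M (\<lambda>\<omega>. ?x \<omega> $ a)" for a
    unfolding square_integrable_def
  proof
    show "(\<lambda>\<omega>. ?x \<omega> $ a) \<in> borel_measurable M"
      unfolding sum_component vector_scaleR_component real_scaleR_def
      by (intro borel_measurable_sum borel_measurable_times square_integrable_measurable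
          square_integrable_component s q)
    have "(norm (?x \<omega> $ a))\<^sup>2 = ?x \<omega> $ a * ?x \<omega> $ a" for \<omega>
      by (simp add: power2_eq_square)
    then show "integrable M (\<lambda>\<omega>. (norm (?x \<omega> $ a))\<^sup>2)"
      unfolding expand by (simp only:) (intro Bochner_Integration.integrable_sum int)
  qed
  then show "square_integrable M ?x"
    by (rule square_integrable_componentwise)
  have "expectation (\<lambda>\<omega>. ?x \<omega> $ a * ?x \<omega> $ b) = (\<Sum>j\<in>J. expectation (\<lambda>\<omega>. q j \<omega> $ a * q j \<omega> $ b))" for a b
  proof -
    have "expectation (\<lambda>\<omega>. ?x \<omega> $ a * ?x \<omega> $ b) =
        (\<Sum>i\<in>J. \<Sum>j\<in>J. expectation (\<lambda>\<omega>. (q i \<omega> $ a * q j \<omega> $ b) * (s i \<omega> * s j \<omega>)))"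
      unfolding expand
      by (subst Bochner_Integration.integral_sum, intro Bochner_Integration.integrable_sum int, assumption+)
         (intro sum.cong refl Bochner_Integration.integral_sum int)
    also have "\<dots> = (\<Sum>i\<in>J. \<Sum>j\<in>J. expectation (\<lambda>\<omega>. q i \<omega> $ a * q j \<omega> $ b) * (if i = j then 1 else 0))"
      by (intro sum.cong refl) (simp only: indep_var_lebesgue_integral [OF indep qq ss] orth)
    also have "\<dots> = (\<Sum>j\<in>J. expectation (\<lambda>\<omega>. q j \<omega> $ a * q j \<omega> $ b))"
      using J by (simp add: if_distrib cong: if_cong)
    finally show ?thesis .
  qed
  then show "second_moment M ?x = (\<Sum>j\<in>J. second_moment M (q j))"
    by (simp add: vec_eq_iff second_moment_def)
qed

section \<open>The closed loop\<close>

text \<open>The space \<open>Q\<close> is arbitrary and only noises before \<open>k\<close> need be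
  measurable, so that the result serves both for \<open>P\<close> and for the product space of noise
  histories up to \<open>k\<close>. The induction is strong because the controller reads the whole
  state history.\<close>

lemma state_measurable:
  fixes A :: "real^'n^'n" and As :: "nat \<Rightarrow> real^'n^'n" and B :: "real^'m^'n"
  assumes \<mu>: "causal N \<mu>"
    and "k \<le> N"
    and "\<And>j. j < k \<Longrightarrow> w j \<in> borel_measurable Q"
    and "\<And>i j. j < k \<Longrightarrow> i \<in> {1..M} \<Longrightarrow> \<sigma> j i \<in> borel_measurable Q"
  shows "(\<lambda>\<omega>. state M A As B w \<sigma> \<mu> \<omega> k) \<in> borel_measurable Q"
  using assms(2-)
proof (induction k rule: less_induct)
  case (less k)
  show ?case
  proof (cases k)
    case (Suc l)
    have [measurable]: "w l \<in> borel_measurable Q"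
      using less.prems Suc by simp
    have \<sigma>: "\<sigma> l i \<in> borel_measurable Q" if "i \<in> {1..M}" for i
      using less.prems Suc that by simp
    have x: "(\<lambda>\<omega>. state M A As B w \<sigma> \<mu> \<omega> j) \<in> borel_measurable Q" if "j \<le> l" for j
      using less that Suc by simp
    have [measurable]: "(\<lambda>\<omega>. G *v state M A As B w \<sigma> \<mu> \<omega> l) \<in> borel_measurable Q" for G :: "real^'n^'n"
      by (rule borel_measurable_continuous_on [OF _ x]) (auto intro!: linear_continuous_on)
    have [measurable]: "(\<lambda>\<omega>. \<Sum>i\<in>{1..M}. \<sigma> l i \<omega> *\<^sub>R (As i *v state M A As B w \<sigma> \<mu> \<omega> l)) \<in> borel_measurable Q"
      using \<sigma> by (intro borel_measurable_sum borel_measurable_scaleR) auto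
    have "\<mu> l \<in> borel_measurable (\<Pi>\<^sub>M j\<in>{..l}. borel)"
      using \<mu> less.prems Suc by (simp add: causal_def)
    then have "(\<lambda>\<omega>. \<mu> l (restrict (\<lambda>j. state M A As B w \<sigma> \<mu> \<omega> j) {..l})) \<in> borel_measurable Q"
      by (rule measurable_compose [rotated]) (auto intro!: measurable_restrict x)
    then have [measurable]: "(\<lambda>\<omega>. B *v \<mu> l (restrict (\<lambda>j. state M A As B w \<sigma> \<mu> \<omega> j) {..l})) \<in> borel_measurable Q"
      by (rule borel_measurable_continuous_on [rotated]) (auto intro!: linear_continuous_on)
    show ?thesis
      unfolding Suc state.simps matrix_vector_mult_add_rdistrib sum_matrix_vector_mult
        scaleR_matrix_vector_assoc [symmetric]
      by measurable
  qed simp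
qed

lemma input_measurable:
  assumes \<mu>: "causal N \<mu>"
    and "k < N"
    and "\<And>j. j < k \<Longrightarrow> w j \<in> borel_measurable Q"
    and "\<And>i j. j < k \<Longrightarrow> i \<in> {1..M} \<Longrightarrow> \<sigma> j i \<in> borel_measurable Q"
  shows "(\<lambda>\<omega>. input M A As B w \<sigma> \<mu> \<omega> k) \<in> borel_measurable Q"
proof -
  have "\<mu> k \<in> borel_measurable (\<Pi>\<^sub>M j\<in>{..k}. borel)"
    using assms by (simp add: causal_def)
  then show ?thesis
    unfolding input_def
    by (rule measurable_compose [rotated])
       (intro measurable_restrict state_measurable [OF \<mu>], use assms in auto)
qed

text \<open>Causality of the closed loop: noises from time \<open>k\<close> on do not influence the
  state at \<open>k\<close>. The two sample points may come from different spaces, which allows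
  passing from \<open>P\<close> to the space of noise histories.\<close>

lemma state_cong:
  assumes "\<And>j. j < k \<Longrightarrow> w j \<omega> = w' j \<omega>'"
    and "\<And>i j. j < k \<Longrightarrow> i \<in> {1..M} \<Longrightarrow> \<sigma> j i \<omega> = \<sigma>' j i \<omega>'"
  shows "state M A As B w \<sigma> \<mu> \<omega> k = state M A As B w' \<sigma>' \<mu> \<omega>' k"
  using assms
proof (induction k rule: less_induct)
  case (less k)
  show ?case
  proof (cases k)
    case (Suc l)
    have x: "state M A As B w \<sigma> \<mu> \<omega> j = state M A As B w' \<sigma>' \<mu> \<omega>' j" if "j \<le> l" for j
      using that Suc less by auto
    have "restrict (state M A As B w \<sigma> \<mu> \<omega>) {..l} = restrict (state M A As B w' \<sigma>' \<mu> \<omega>') {..l}"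
      by (rule restrict_ext) (simp add: x)
    moreover have "(\<Sum>i\<in>{1..M}. \<sigma> l i \<omega> *\<^sub>R As i) = (\<Sum>i\<in>{1..M}. \<sigma>' l i \<omega>' *\<^sub>R As i)"
      by (rule sum.cong) (use less.prems Suc in auto)
    moreover have "w l \<omega> = w' l \<omega>'"
      using less.prems Suc by simp
    ultimately show ?thesis
      by (simp add: Suc x)
  qed simp
qed

lemma input_cong:
  assumes "\<And>j. j < k \<Longrightarrow> w j \<omega> = w' j \<omega>'"
    and "\<And>i j. j < k \<Longrightarrow> i \<in> {1..M} \<Longrightarrow> \<sigma> j i \<omega> = \<sigma>' j i \<omega>'"
  shows "input M A As B w \<sigma> \<mu> \<omega> k = input M A As B w' \<sigma>' \<mu> \<omega>' k"
proof -
  have "restrict (state M A As B w \<sigma> \<mu> \<omega>) {..k} = restrict (state M A As B w' \<sigma>' \<mu> \<omega>') {..k}"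
    by (intro restrict_ext state_cong) (use assms in auto)
  then show ?thesis
    by (simp add: input_def)
qed

section \<open>The noise process and its moments\<close>

locale stochastic_system = prob_space P
  for P :: "'a measure" +
  fixes M :: nat and A :: "real^'n^'n" and As :: "nat \<Rightarrow> real^'n^'n" and B :: "real^'m^'n"
    and w :: "nat \<Rightarrow> 'a \<Rightarrow> real^'n" and \<sigma> :: "nat \<Rightarrow> nat \<Rightarrow> 'a \<Rightarrow> real"
  assumes white: "white_noises P M w \<sigma>"
begin

definition noise :: "nat \<Rightarrow> 'a \<Rightarrow> (real^'n) \<times> (nat \<Rightarrow> real)" where
  "noise k \<omega> = (w k \<omega>, \<lambda>i\<in>{1..M}. \<sigma> k i \<omega>)"

abbreviation noise_space :: "((real^'n) \<times> (nat \<Rightarrow> real)) measure" where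
  "noise_space \<equiv> borel \<Otimes>\<^sub>M (\<Pi>\<^sub>M i\<in>{1..M}. borel)"

definition state_input :: "('n, 'm) controller \<Rightarrow> nat \<Rightarrow> 'a \<Rightarrow> real^('n + 'm)" where
  "state_input \<mu> k \<omega> = block_vec (state M A As B w \<sigma> \<mu> \<omega> k) (input M A As B w \<sigma> \<mu> \<omega> k)"

lemma indep_noise: "indep_vars (\<lambda>_. noise_space) noise UNIV"
  using white unfolding white_noises_def noise_def by blast

lemma noise_measurable: "noise k \<in> measurable P noise_space"
  using indep_noise by (simp add: indep_vars_def)

lemma w_measurable: "w k \<in> borel_measurable P"
  using measurable_compose [OF noise_measurable measurable_fst] by (simp add: noise_def)

lemma \<sigma>_measurable:
  assumes "i \<in> {1..M}" shows "\<sigma> k i \<in> borel_measurable P"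
proof -
  have "(\<lambda>\<omega>. snd (noise k \<omega>) i) \<in> borel_measurable P"
    by (intro measurable_compose [OF measurable_compose [OF noise_measurable measurable_snd]]
        measurable_component_singleton assms)
  then show ?thesis
    using assms by (simp add: noise_def)
qed

lemma
  shows integrable_w_w: "integrable P (\<lambda>\<omega>. w k \<omega> $ c * w k \<omega> $ d)"
    and expectation_w_w: "expectation (\<lambda>\<omega>. w k \<omega> $ c * w k \<omega> $ d) = (if c = d then 1 else 0)"
proof -
  let ?W = "\<lambda>\<omega>. (columnvector (w k \<omega>) :: real^1^'n) ** rowvector (w k \<omega>)"
  have W: "integral\<^sup>L P ?W = mat 1"
    using white by (simp add: white_noises_def)
  \<comment> \<open>The Bochner integral of a non-integrable function is 0, so the nonzero value
    forces integrability.\<close>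
  moreover have "(mat 1 :: real^'n^'n) \<noteq> 0"
    by (simp add: mat_def vec_eq_iff)
  ultimately have int: "integrable P ?W"
    by (metis not_integrable_integral_eq)
  have comp: "bounded_linear (\<lambda>S::real^'n^'n. S $ c $ d)"
    by (intro bounded_linear_compose [OF bounded_linear_vec_nth] bounded_linear_vec_nth)
  have *: "?W \<omega> $ c $ d = w k \<omega> $ c * w k \<omega> $ d" for \<omega>
    by (simp add: columnvector_def rowvector_def matrix_matrix_mult_def)
  show "integrable P (\<lambda>\<omega>. w k \<omega> $ c * w k \<omega> $ d)"
    using integrable_bounded_linear [OF comp int] unfolding * .
  show "expectation (\<lambda>\<omega>. w k \<omega> $ c * w k \<omega> $ d) = (if c = d then 1 else 0)"
    using integral_bounded_linear [OF comp int] unfolding * W by (simp add: mat_def)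
qed

lemma square_integrable_w_component: "square_integrable P (\<lambda>\<omega>. w k \<omega> $ c)"
proof -
  have "(\<lambda>\<omega>. w k \<omega> $ c) \<in> borel_measurable P"
    by (rule borel_measurable_continuous_on [OF _ w_measurable]) (intro continuous_intros)
  then show ?thesis
    using integrable_w_w [of k c c] by (simp add: square_integrable_def power2_eq_square)
qed

lemma square_integrable_w: "square_integrable P (w k)"
  by (intro square_integrable_componentwise square_integrable_w_component)

lemma square_integrable_\<sigma>:
  assumes "i \<in> {1..M}" shows "square_integrable P (\<sigma> k i)"
proof -
  have "expectation (\<lambda>\<omega>. \<sigma> k i \<omega> * \<sigma> k i \<omega>) = 1"
    using white assms by (simp add: white_noises_def)
  then have "integrable P (\<lambda>\<omega>. \<sigma> k i \<omega> * \<sigma> k i \<omega>)"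
    by (metis not_integrable_integral_eq zero_neq_one)
  then show ?thesis
    using \<sigma>_measurable [OF assms] by (simp add: square_integrable_def power2_eq_square)
qed

lemma expectation_w: "expectation (\<lambda>\<omega>. w k \<omega> $ c) = 0"
proof -
  \<comment> \<open>On a probability space the constant 1 is square integrable, and multiplying by
    it turns square integrability into integrability.\<close>
  have "integrable P (w k)"
    using square_integrable_scaleR [of P "\<lambda>_. 1", OF _ square_integrable_w]
    by (simp add: square_integrable_def)
  then show ?thesis
    using white integral_bounded_linear [OF bounded_linear_vec_nth, of P "w k" c]
    by (simp add: white_noises_def)
qed

lemma expectation_\<sigma>_w:
  assumes "i \<in> {1..M}" shows "expectation (\<lambda>\<omega>. \<sigma> k i \<omega> * w k \<omega> $ c) = 0"
proof -
  have "integrable P (\<lambda>\<omega>. \<sigma> k i \<omega> *\<^sub>R w k \<omega>)"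
    by (intro square_integrable_scaleR square_integrable_\<sigma> square_integrable_w assms)
  then show ?thesis
    using white assms integral_bounded_linear [OF bounded_linear_vec_nth, of P "\<lambda>\<omega>. \<sigma> k i \<omega> *\<^sub>R w k \<omega>" c]
    by (simp add: white_noises_def)
qed

section \<open>Independence of past and present noise, and the second moment recursion\<close>

lemma state_input_measurable:
  assumes "causal N \<mu>" "k < N"
  shows "state_input \<mu> k \<in> borel_measurable P"
  unfolding state_input_def
  by (intro block_vec_measurable state_measurable [OF assms(1)] input_measurable [OF assms]
      w_measurable \<sigma>_measurable less_imp_le assms)

text \<open>State and input at time \<open>k\<close> are a measurable function of the noises with
  index in \<open>{..<k}\<close>, a set disjoint from \<open>{k}\<close>. Independent families stay
  independent when grouped over disjoint index sets.\<close>

lemma indep_state_input_noise: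
  assumes \<mu>: "causal N \<mu>" and k: "k < N"
    and \<phi>: "\<phi> \<in> measurable borel S" and \<psi>: "\<psi> \<in> measurable noise_space T"
  shows "indep_var S (\<lambda>\<omega>. \<phi> (state_input \<mu> k \<omega>)) T (\<lambda>\<omega>. \<psi> (noise k \<omega>))"
proof -
  \<comment> \<open>The closed loop is rerun with a noise history \<open>h\<close> as sample point;
    \<open>?w\<close> and \<open>?\<sigma>\<close> read off its coordinates.\<close>
  let ?w = "\<lambda>j h. fst (h j)" and ?\<sigma> = "\<lambda>j i h. snd (h j) i"
  let ?g = "\<lambda>h. block_vec (state M A As B ?w ?\<sigma> \<mu> h k) (input M A As B ?w ?\<sigma> \<mu> h k)"
  let ?Q = "\<Pi>\<^sub>M j\<in>{..<k}. noise_space"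
  have noise: "(\<lambda>h. h j) \<in> measurable (\<Pi>\<^sub>M j\<in>J. noise_space) noise_space" if "j \<in> J" for j and J :: "nat set"
    by (rule measurable_component_singleton [OF that])
  have w: "?w j \<in> borel_measurable ?Q" if "j < k" for j
    by (rule measurable_compose [OF noise measurable_fst]) (use that in simp)
  have \<sigma>: "?\<sigma> j i \<in> borel_measurable ?Q" if "j < k" "i \<in> {1..M}" for i j
    by (rule measurable_compose [OF measurable_compose [OF noise measurable_snd]
          measurable_component_singleton]) (use that in auto)
  have g: "?g \<in> borel_measurable ?Q"
    by (intro block_vec_measurable state_measurable [OF \<mu>] input_measurable [OF \<mu> k] w \<sigma> less_imp_le k)
  have "(\<lambda>h. \<phi> (?g h)) \<in> measurable ?Q S"
    by (rule measurable_compose [OF g \<phi>])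
  moreover have "(\<lambda>h. \<psi> (h k)) \<in> measurable (\<Pi>\<^sub>M j\<in>{k}. noise_space) T"
    by (rule measurable_compose [OF noise \<psi>]) simp
  ultimately have "indep_var S ((\<lambda>h. \<phi> (?g h)) \<circ> (\<lambda>\<omega>. restrict (\<lambda>j. noise j \<omega>) {..<k}))
      T ((\<lambda>h. \<psi> (h k)) \<circ> (\<lambda>\<omega>. restrict (\<lambda>j. noise j \<omega>) {k}))"
    by (intro indep_var_compose [OF indep_var_restrict [OF indep_noise]]) auto
  \<comment> \<open>The restricted history is undefined from time \<open>k\<close> on, which is
    harmless since \<open>?g\<close> depends only on earlier coordinates.\<close>
  moreover have "?g (restrict (\<lambda>j. noise j \<omega>) {..<k}) = state_input \<mu> k \<omega>" for \<omega>
    unfolding state_input_def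
    by (intro arg_cong2 [of _ _ _ _ block_vec] state_cong input_cong) (auto simp: noise_def)
  ultimately show ?thesis
    by (simp add: comp_def)
qed

text \<open>
  The state update is \<open>x\<^sub>k\<^sub>+\<^sub>1 = \<Sum>\<^sub>j s\<^sub>j q\<^sub>j\<close>, with the orthonormal family \<open>s\<close> consisting of \<open>1\<close> (index
  \<open>Inl 0\<close>), \<open>\<sigma>\<^sub>k(i)\<close> (index \<open>Inl i\<close>) and the components of \<open>w\<^sub>k\<close> (index \<open>Inr c\<close>), and with \<open>q\<close>
  determined by the past.
\<close>

definition noise_factor :: "nat + 'n \<Rightarrow> (real^'n) \<times> (nat \<Rightarrow> real) \<Rightarrow> real" where
  "noise_factor j z = (case j of Inl i \<Rightarrow> if i = 0 then 1 else snd z i | Inr c \<Rightarrow> fst z $ c)"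

definition past_factor :: "nat + 'n \<Rightarrow> real^('n + 'm) \<Rightarrow> real^'n" where
  "past_factor j v = (case j of Inl i \<Rightarrow> if i = 0 then hcat A B *v v else (As i ** F) *v v
                              | Inr c \<Rightarrow> axis c 1)"

abbreviation factor_indices :: "(nat + 'n) set" where
  "factor_indices \<equiv> {..M} <+> UNIV"

lemma sum_factor_indices:
  fixes f :: "nat + 'n \<Rightarrow> 'b::comm_monoid_add"
  shows "sum f factor_indices = f (Inl 0) + (\<Sum>i\<in>{1..M}. f (Inl i)) + (\<Sum>c\<in>UNIV. f (Inr c))"
proof -
  have "{..M} = insert 0 {1..M}"
    by auto
  then have "(\<Sum>i\<in>{..M}. f (Inl i)) = f (Inl 0) + (\<Sum>i\<in>{1..M}. f (Inl i))"
    by simp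
  then show ?thesis
    by (simp add: sum.Plus)
qed

lemma state_Suc_factors:
  "state M A As B w \<sigma> \<mu> \<omega> (Suc k) =
     (\<Sum>j\<in>factor_indices. noise_factor j (noise k \<omega>) *\<^sub>R past_factor j (state_input \<mu> k \<omega>))"
proof -
  have "(\<Sum>c\<in>UNIV. w k \<omega> $ c *\<^sub>R axis c 1) = w k \<omega>"
    by (simp add: vec_eq_iff axis_def if_distrib cong: if_cong)
  then show ?thesis
    by (simp add: sum_factor_indices noise_factor_def past_factor_def noise_def state_input_def
        hcat_mult_block_vec F_mult_block_vec matrix_vector_mult_add_rdistrib sum_matrix_vector_mult
        input_def scaleR_matrix_vector_assoc algebra_simps flip: matrix_vector_mul_assoc)
qed

lemma factor_index_cases:
  assumes "j \<in> factor_indices"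
  obtains "j = Inl 0" | i where "j = Inl i" "i \<noteq> 0" "i \<in> {1..M}" | c where "j = Inr c"
proof (cases j)
  case (Inl i)
  then show ?thesis
    using assms that(1,2) by (cases "i = 0") auto
qed (rule that(3))

lemma noise_factor_simps:
  "noise_factor (Inl 0) z = 1"
  "i \<noteq> 0 \<Longrightarrow> noise_factor (Inl i) z = snd z i"
  "noise_factor (Inr c) z = fst z $ c"
  by (simp_all add: noise_factor_def)

lemma noise_factor_noise:
  "i \<noteq> 0 \<Longrightarrow> i \<in> {1..M} \<Longrightarrow> noise_factor (Inl i) (noise k \<omega>) = \<sigma> k i \<omega>"
  "noise_factor (Inr c) (noise k \<omega>) = w k \<omega> $ c"
  by (simp_all add: noise_factor_def noise_def)

lemma noise_factor_measurable:
  assumes "j \<in> factor_indices"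
  shows "(\<lambda>z. noise_factor j z) \<in> borel_measurable noise_space"
  using assms
proof (cases rule: factor_index_cases)
  case (2 i)
  then show ?thesis
    unfolding 2(1) noise_factor_simps(2) [OF 2(2)]
    by (intro measurable_compose [OF measurable_snd measurable_component_singleton])
next
  case (3 c)
  show ?thesis
    unfolding 3 noise_factor_simps
    by (rule borel_measurable_continuous_on [OF _ measurable_fst]) (intro continuous_intros)
qed (simp add: noise_factor_simps)

lemma square_integrable_noise_factor:
  assumes "j \<in> factor_indices"
  shows "square_integrable P (\<lambda>\<omega>. noise_factor j (noise k \<omega>))"
  using assms
proof (cases rule: factor_index_cases)
  case (2 i)
  show ?thesis
    unfolding 2(1) noise_factor_noise(1) [OF 2(2,3)] by (rule square_integrable_\<sigma> [OF 2(3)])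
next
  case (3 c)
  then show ?thesis
    by (simp only: noise_factor_noise square_integrable_w_component)
qed (simp add: noise_factor_simps square_integrable_def)

text \<open>Each pair of index kinds uses one property: total mass 1 for the constant with itself,
  zero means for the constant with a noise, the given covariances within one kind of noise, and
  uncorrelatedness for \<sigma> with w.\<close>

lemma noise_factor_orthonormal:
  assumes "i \<in> factor_indices" "j \<in> factor_indices"
  shows "expectation (\<lambda>\<omega>. noise_factor i (noise k \<omega>) * noise_factor j (noise k \<omega>)) = (if i = j then 1 else 0)"
proof -
  have \<sigma>: "expectation (\<sigma> k a) = 0" if "a \<in> {1..M}" for a
    using white that by (simp add: white_noises_def)
  have \<sigma>\<sigma>: "expectation (\<lambda>\<omega>. \<sigma> k a \<omega> * \<sigma> k b \<omega>) = (if a = b then 1 else 0)"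
    if "a \<in> {1..M}" "b \<in> {1..M}" for a b
    using white that by (simp add: white_noises_def)
  have \<sigma>w: "expectation (\<lambda>\<omega>. w k \<omega> $ c * \<sigma> k a \<omega>) = 0" if "a \<in> {1..M}" for a c
    using expectation_\<sigma>_w [OF that, of k c] by (simp add: mult.commute)
  show ?thesis
    using assms(1)
  proof (cases rule: factor_index_cases)
    case 1
    with assms(2) show ?thesis
      by (cases rule: factor_index_cases)
         (simp_all add: noise_factor_simps(1) noise_factor_noise \<sigma> expectation_w prob_space del: atLeastAtMost_iff)
  next
    case (2 a)
    from assms(2) 2 show ?thesis
      by (cases rule: factor_index_cases)
         (simp_all add: noise_factor_simps(1) noise_factor_noise \<sigma> \<sigma>\<sigma> expectation_\<sigma>_w del: atLeastAtMost_iff)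
  next
    case (3 c)
    with assms(2) show ?thesis
      by (cases rule: factor_index_cases)
         (simp_all add: noise_factor_simps(1) noise_factor_noise \<sigma>w expectation_w expectation_w_w del: atLeastAtMost_iff)
  qed
qed

lemma past_factor_simps:
  "past_factor (Inl 0) v = hcat A B *v v"
  "i \<noteq> 0 \<Longrightarrow> past_factor (Inl i) v = (As i ** F) *v v"
  "past_factor (Inr c) v = axis c 1"
  by (simp_all add: past_factor_def)

lemma past_factor_measurable: "(\<lambda>v. past_factor j v) \<in> borel_measurable borel"
proof (cases j)
  case (Inl i)
  have "(\<lambda>v. G *v v) \<in> borel_measurable borel" for G :: "real^('n + 'm)^'n"
    by (auto intro!: borel_measurable_continuous_onI linear_continuous_on)
  then show ?thesis
    unfolding Inl by (cases "i = 0") (simp_all only: past_factor_simps simp_thms)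
qed (simp add: past_factor_simps)

lemma square_integrable_past_factor:
  assumes "square_integrable P f"
  shows "square_integrable P (\<lambda>\<omega>. past_factor j (f \<omega>))"
proof (cases j)
  case (Inl i)
  show ?thesis
    unfolding Inl
    by (cases "i = 0") (simp_all only: past_factor_simps simp_thms square_integrable_matrix_mult assms)
qed (simp add: past_factor_simps square_integrable_def)

text \<open>With \<open>noise_factor\<close> as the orthonormal family and
  \<open>past_factor\<close> as its coefficients, the sum over indices splits into the three groups
  of terms of the constraint.\<close>

lemma
  assumes \<mu>: "causal N \<mu>" and k: "k < N" and f: "square_integrable P (state_input \<mu> k)"
  shows square_integrable_state_Suc: "square_integrable P (\<lambda>\<omega>. state M A As B w \<sigma> \<mu> \<omega> (Suc k))"
    and second_moment_state_Suc: "second_moment P (\<lambda>\<omega>. state M A As B w \<sigma> \<mu> \<omega> (Suc k)) =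
      hcat A B ** second_moment P (state_input \<mu> k) ** transpose (hcat A B)
      + (\<Sum>i\<in>{1..M}. As i ** F ** second_moment P (state_input \<mu> k) ** transpose F ** transpose (As i))
      + mat 1"
proof -
  have indep: "indep_var borel (\<lambda>\<omega>. past_factor i (state_input \<mu> k \<omega>) $ a * past_factor j (state_input \<mu> k \<omega>) $ b)
      borel (\<lambda>\<omega>. noise_factor i (noise k \<omega>) * noise_factor j (noise k \<omega>))"
    if "i \<in> factor_indices" "j \<in> factor_indices" for i j a b
  proof -
    have [measurable]: "(\<lambda>v. past_factor j v $ c) \<in> borel_measurable borel" for j c
      by (rule borel_measurable_continuous_on [OF _ past_factor_measurable]) (intro continuous_intros)
    have [measurable]: "noise_factor i \<in> borel_measurable noise_space" "noise_factor j \<in> borel_measurable noise_space"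
      using that by (blast intro: noise_factor_measurable)+
    show ?thesis
      by (rule indep_state_input_noise [OF \<mu> k]) measurable
  qed
  show "square_integrable P (\<lambda>\<omega>. state M A As B w \<sigma> \<mu> \<omega> (Suc k))"
    unfolding state_Suc_factors
    by (rule second_moment_orthonormal_combination(1) [OF _ square_integrable_noise_factor
      noise_factor_orthonormal square_integrable_past_factor [OF f] indep]) auto
  have "second_moment P (\<lambda>\<omega>. state M A As B w \<sigma> \<mu> \<omega> (Suc k)) =
      (\<Sum>j\<in>factor_indices. second_moment P (\<lambda>\<omega>. past_factor j (state_input \<mu> k \<omega>)))"
    unfolding state_Suc_factors
    by (rule second_moment_orthonormal_combination(2) [OF _ square_integrable_noise_factor
      noise_factor_orthonormal square_integrable_past_factor [OF f] indep]) auto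
  also have "\<dots> = second_moment P (\<lambda>\<omega>. hcat A B *v state_input \<mu> k \<omega>)
      + (\<Sum>i\<in>{1..M}. second_moment P (\<lambda>\<omega>. (As i ** F) *v state_input \<mu> k \<omega>)) + mat 1"
  proof -
    \<comment> \<open>Each component of \<open>w k\<close> contributes the outer product of a unit
      vector with itself; together they give the identity.\<close>
    have "(\<Sum>c\<in>UNIV. second_moment P (\<lambda>\<omega>. axis c 1 :: real^'n)) = mat 1"
    proof -
      have "axis c 1 $ i * axis c 1 $ j = (if c = i then if i = j then 1 else 0 else (0::real))" for c i j :: 'n
        by (simp add: axis_def)
      then show ?thesis
        by (simp add: vec_eq_iff second_moment_def mat_def prob_space)
    qed
    then show ?thesis
      by (simp add: sum_factor_indices past_factor_def)
  qed
  finally show "second_moment P (\<lambda>\<omega>. state M A As B w \<sigma> \<mu> \<omega> (Suc k)) =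
      hcat A B ** second_moment P (state_input \<mu> k) ** transpose (hcat A B)
      + (\<Sum>i\<in>{1..M}. As i ** F ** second_moment P (state_input \<mu> k) ** transpose F ** transpose (As i))
      + mat 1"
    by (simp add: second_moment_congruence [OF f, symmetric] matrix_transpose_mul matrix_mul_assoc)
qed

end

lemma causal_sdp_controller:
  fixes X :: "nat \<Rightarrow> real^'n^'n" and R :: "nat \<Rightarrow> real^'m^'n"
  shows "causal N (sdp_controller X R)"
  unfolding causal_def sdp_controller_def
proof (intro allI impI)
  fix k :: nat
  have "(\<lambda>h. h k) \<in> borel_measurable (\<Pi>\<^sub>M j\<in>{..k}. (borel :: (real^'n) measure))"
    by (rule measurable_component_singleton) simp
  then show "(\<lambda>h. (transpose (R k) ** matrix_inv (X k)) *v h k) \<in> borel_measurable (\<Pi>\<^sub>M j\<in>{..k}. borel)"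
    by (rule borel_measurable_continuous_on [rotated]) (auto intro!: linear_continuous_on)
qed

section \<open>Second moments of the closed loop and the two costs\<close>

context stochastic_system
begin

lemma perf_output_eq:
  "perf_output M A As B C D w \<sigma> \<mu> \<omega> k = hcat C D *v state_input \<mu> k \<omega>"
  by (simp add: perf_output_def state_input_def hcat_mult_block_vec)

lemma F_second_moment:
  assumes "square_integrable P (state_input \<mu> k)"
  shows "F ** second_moment P (state_input \<mu> k) ** transpose F
    = second_moment P (\<lambda>\<omega>. state M A As B w \<sigma> \<mu> \<omega> k)"
  unfolding second_moment_congruence [OF assms] by (simp add: state_input_def F_mult_block_vec)

text \<open>The moment recursion is the equality constraint, once the congruence by \<open>F\<close>
  is recognized as the second moment of the state.\<close>

lemma sdp_feasible_second_moment:
  assumes \<mu>: "causal N \<mu>" and f: "\<And>k. k < N \<Longrightarrow> square_integrable P (state_input \<mu> k)"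
  shows "sdp_feasible N M A As B (\<lambda>k. second_moment P (state_input \<mu> k))"
  unfolding sdp_feasible_def
proof (intro conjI allI impI)
  fix k assume k: "k + 1 < N"
  show "F ** second_moment P (state_input \<mu> (k + 1)) ** transpose F =
      hcat A B ** second_moment P (state_input \<mu> k) ** transpose (hcat A B)
      + (\<Sum>i\<in>{1..M}. As i ** F ** second_moment P (state_input \<mu> k) ** transpose F ** transpose (As i)) + mat 1"
    using k second_moment_state_Suc [OF \<mu> _ f, of k] F_second_moment [OF f, of "k + 1"] by simp
qed (intro pos_semidef_second_moment f)

text \<open>The expectation of \<open>z \<bullet> z\<close> is the trace of the second moment of
  \<open>z\<close>, a congruence of the joint moment by \<open>hcat C D\<close>. Square
  integrability makes the extended integral agree with the real one.\<close>

lemma control_cost_eq_sdp_cost: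
  assumes f: "\<And>k. k < N \<Longrightarrow> square_integrable P (state_input \<mu> k)"
  shows "control_cost P N M A As B C D w \<sigma> \<mu>
    = ennreal (sdp_cost N C D (\<lambda>k. second_moment P (state_input \<mu> k)))"
proof -
  let ?t = "\<lambda>k. trace (hcat C D ** second_moment P (state_input \<mu> k) ** transpose (hcat C D))"
  have *: "(\<integral>\<^sup>+ \<omega>. ennreal (perf_output M A As B C D w \<sigma> \<mu> \<omega> k \<bullet> perf_output M A As B C D w \<sigma> \<mu> \<omega> k) \<partial>P)
      = ennreal (?t k)" and nonneg: "0 \<le> ?t k" if "k < N" for k
  proof -
    have z: "square_integrable P (\<lambda>\<omega>. hcat C D *v state_input \<mu> k \<omega>)"
      by (intro square_integrable_matrix_mult f that)
    then have "integrable P (\<lambda>\<omega>. (hcat C D *v state_input \<mu> k \<omega>) \<bullet> (hcat C D *v state_input \<mu> k \<omega>))"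
      by (simp add: square_integrable_def power2_norm_eq_inner)
    then show "(\<integral>\<^sup>+ \<omega>. ennreal (perf_output M A As B C D w \<sigma> \<mu> \<omega> k \<bullet> perf_output M A As B C D w \<sigma> \<mu> \<omega> k) \<partial>P)
        = ennreal (?t k)"
      unfolding perf_output_eq second_moment_congruence [OF f [OF that]] trace_second_moment [OF z]
      by (intro nn_integral_eq_integral) simp_all
    show "0 \<le> ?t k"
      unfolding second_moment_congruence [OF f [OF that]] trace_second_moment [OF z] by simp
  qed
  have "(\<Sum>k<N. \<integral>\<^sup>+ \<omega>. ennreal (perf_output M A As B C D w \<sigma> \<mu> \<omega> k \<bullet> perf_output M A As B C D w \<sigma> \<mu> \<omega> k) \<partial>P)
      = (\<Sum>k<N. ennreal (?t k))"
    by (intro sum.cong refl *) simp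
  also have "\<dots> = ennreal (\<Sum>k<N. ?t k)"
    by (intro sum_ennreal nonneg) simp
  finally show ?thesis
    unfolding control_cost_def sdp_cost_def by (simp only: ennreal_mult' zero_le_divide_1_iff of_nat_0_le_iff)
qed

text \<open>Definiteness makes \<open>hcat C D\<close> injective, hence bounded below by some
  \<open>c > 0\<close>. The output energy therefore controls state and input together.\<close>

lemma square_integrable_of_finite_cost:
  assumes "causal N \<mu>" "N > 0" and pd: "pos_def (transpose (hcat C D) ** hcat C D)"
    and fin: "control_cost P N M A As B C D w \<sigma> \<mu> < \<top>" and k: "k < N"
  shows "square_integrable P (state_input \<mu> k)"
proof -
  have "inj ((*v) (hcat C D))"
    unfolding linear_injective_0 [OF matrix_vector_mul_linear]
  proof (intro allI impI)
    fix v assume v: "hcat C D *v v = 0"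
    have "v \<bullet> ((transpose (hcat C D) ** hcat C D) *v v) = 0"
      using v by (simp flip: matrix_vector_mul_assoc)
    then show "v = 0"
      using pd unfolding pos_def_def by (metis less_irrefl)
  qed
  then obtain c where c: "c > 0" "\<And>v. c * norm v \<le> norm (hcat C D *v v)"
    using linear_inj_bounded_below_pos [OF matrix_vector_mul_linear] by blast
  have [measurable]: "state_input \<mu> k \<in> borel_measurable P"
    by (rule state_input_measurable [OF assms(1) k])
  have z: "(norm (hcat C D *v v))\<^sup>2 = (hcat C D *v v) \<bullet> (hcat C D *v v)" for v
    by (rule power2_norm_eq_inner)
  have [measurable]: "(\<lambda>\<omega>. hcat C D *v state_input \<mu> k \<omega>) \<in> borel_measurable P"
    by (rule borel_measurable_continuous_on) (auto intro!: linear_continuous_on)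
  have "(\<integral>\<^sup>+ \<omega>. ennreal ((norm (hcat C D *v state_input \<mu> k \<omega>))\<^sup>2) \<partial>P) < \<top>"
  proof -
    \<comment> \<open>As \<open>N > 0\<close>, the factor \<open>1 / N\<close> is nonzero, so
      finiteness passes from the cost to the sum.\<close>
    have "(\<Sum>k<N. \<integral>\<^sup>+ \<omega>. ennreal ((norm (hcat C D *v state_input \<mu> k \<omega>))\<^sup>2) \<partial>P) < \<top>"
      using fin \<open>N > 0\<close> unfolding control_cost_def perf_output_eq z [symmetric]
      by (auto simp: ennreal_mult_less_top)
    moreover have "(\<integral>\<^sup>+ \<omega>. ennreal ((norm (hcat C D *v state_input \<mu> k \<omega>))\<^sup>2) \<partial>P)
        \<le> (\<Sum>k<N. \<integral>\<^sup>+ \<omega>. ennreal ((norm (hcat C D *v state_input \<mu> k \<omega>))\<^sup>2) \<partial>P)"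
      using k by (intro member_le_sum) auto
    ultimately show ?thesis
      by (rule le_less_trans [rotated])
  qed
  then have int: "integrable P (\<lambda>\<omega>. (norm (hcat C D *v state_input \<mu> k \<omega>))\<^sup>2)"
    by (intro integrableI_nonneg) auto
  have "integrable P (\<lambda>\<omega>. c\<^sup>2 * (norm (state_input \<mu> k \<omega>))\<^sup>2)"
  proof (rule Bochner_Integration.integrable_bound [OF int])
    have "c\<^sup>2 * (norm v)\<^sup>2 \<le> (norm (hcat C D *v v))\<^sup>2" for v
      using power_mono [OF c(2) [of v], of 2] c(1) by (simp add: power_mult_distrib)
    then show "AE \<omega> in P. norm (c\<^sup>2 * (norm (state_input \<mu> k \<omega>))\<^sup>2) \<le> norm ((norm (hcat C D *v state_input \<mu> k \<omega>))\<^sup>2)"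
      by (simp add: abs_mult)
  qed measurable
  then show ?thesis
    using c(1) by (simp add: square_integrable_def state_input_measurable [OF assms(1) k])
qed

lemma sdp_cost_le_control_cost:
  assumes "causal N \<mu>" "N > 0" "pos_def (transpose (hcat C D) ** hcat C D)"
    and opt: "is_arg_min (sdp_cost N C D) (sdp_feasible N M A As B) V"
  shows "ennreal (sdp_cost N C D V) \<le> control_cost P N M A As B C D w \<sigma> \<mu>"
\<comment> \<open>An infinite cost exceeds every bound; a finite one ensures that the moments exist
  and form a feasible point.\<close>
proof (cases "control_cost P N M A As B C D w \<sigma> \<mu> < \<top>")
  case True
  then have f: "\<And>k. k < N \<Longrightarrow> square_integrable P (state_input \<mu> k)"
    by (rule square_integrable_of_finite_cost [OF assms(1-3)])
  have "sdp_cost N C D V \<le> sdp_cost N C D (\<lambda>k. second_moment P (state_input \<mu> k))"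
    using opt sdp_feasible_second_moment [OF assms(1) f] unfolding is_arg_min_def by (meson not_le)
  moreover have "control_cost P N M A As B C D w \<sigma> \<mu>
      = ennreal (sdp_cost N C D (\<lambda>k. second_moment P (state_input \<mu> k)))"
    by (intro control_cost_eq_sdp_cost f)
  ultimately show ?thesis
    by (simp add: ennreal_leI)
qed (simp add: not_less top_unique)

section \<open>The loop closed by the controller obtained from the program\<close>

lemma state_input_sdp_controller:
  "state_input (sdp_controller X R) k \<omega> =
    vcat (mat 1) (transpose (R k) ** matrix_inv (X k)) *v state M A As B w \<sigma> (sdp_controller X R) \<omega> k"
  by (simp add: state_input_def input_def sdp_controller_def vcat_mult_vec)

text \<open>Under linear feedback the pair of state and input is a linear image of the state, so
  finite second moments propagate from the zero initial state.\<close>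

lemma square_integrable_sdp_controller: "square_integrable P (state_input (sdp_controller X R) k)"
proof -
  have "square_integrable P (\<lambda>\<omega>. state M A As B w \<sigma> (sdp_controller X R) \<omega> k)"
  proof (induction k)
    case (Suc k)
    then have "square_integrable P (state_input (sdp_controller X R) k)"
      unfolding state_input_sdp_controller [abs_def] by (rule square_integrable_matrix_mult)
    then show ?case
      by (rule square_integrable_state_Suc [OF causal_sdp_controller lessI])
  qed (simp add: square_integrable_def)
  then show ?thesis
    unfolding state_input_sdp_controller [abs_def] by (rule square_integrable_matrix_mult)
qed

lemma second_moment_sdp_controller_le:
  assumes feas: "sdp_feasible N M A As B V"
    and V: "\<And>k. k < N \<Longrightarrow> V k = vcat (hcat (X k) (R k)) (hcat (transpose (R k)) (U k))"
    and k: "k < N"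
  shows "v \<bullet> (second_moment P (state_input (sdp_controller X R) k) *v v) \<le> v \<bullet> (V k *v v)"
  using k
proof (induction k arbitrary: v)
  case 0
  \<comment> \<open>The zero initial state makes the input zero whatever matrix
    \<open>matrix_inv (X 0)\<close> is, so invertibility is needed only from time 1 on.\<close>
  have "state_input (sdp_controller X R) 0 = (\<lambda>\<omega>. 0)"
    unfolding state_input_sdp_controller [abs_def] by simp
  then have "second_moment P (state_input (sdp_controller X R) 0) = 0"
    by (simp add: second_moment_def vec_eq_iff)
  then show ?case
    using feas 0 by (simp add: sdp_feasible_def pos_semidef_def)
next
  case (Suc k)
  let ?\<mu> = "sdp_controller X R" and ?K = "transpose (R (Suc k)) ** matrix_inv (X (Suc k))"
  let ?S = "\<lambda>k. second_moment P (state_input ?\<mu> k)"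
  let ?x = "\<lambda>\<omega>. state M A As B w \<sigma> ?\<mu> \<omega> (Suc k)"
  have x: "square_integrable P ?x"
    by (rule square_integrable_state_Suc [OF causal_sdp_controller lessI square_integrable_sdp_controller])
  have FV: "F ** V (Suc k) ** transpose F = X (Suc k)"
    by (simp add: V [OF Suc.prems] F_block_congruence)
  \<comment> \<open>Grouping \<open>As i ** F\<close> writes every term as a congruence of
    \<open>V k\<close>, so one monotonicity argument covers them all.\<close>
  have X: "X (Suc k) = hcat A B ** V k ** transpose (hcat A B)
      + (\<Sum>i\<in>{1..M}. (As i ** F) ** V k ** transpose (As i ** F)) + mat 1"
    using feas Suc.prems
    by (simp add: sdp_feasible_def FV [symmetric] matrix_transpose_mul matrix_mul_assoc)
  have S: "second_moment P ?x = hcat A B ** ?S k ** transpose (hcat A B)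
      + (\<Sum>i\<in>{1..M}. (As i ** F) ** ?S k ** transpose (As i ** F)) + mat 1"
    unfolding second_moment_state_Suc [OF causal_sdp_controller lessI square_integrable_sdp_controller]
    by (simp add: matrix_transpose_mul matrix_mul_assoc)
  have psd: "0 \<le> u \<bullet> (V k *v u)" for u
    using feas Suc.prems by (simp add: sdp_feasible_def pos_semidef_def)
  have le: "u \<bullet> (second_moment P ?x *v u) \<le> u \<bullet> (X (Suc k) *v u)" for u
    unfolding S X matrix_vector_mult_add_rdistrib sum_matrix_vector_mult inner_add_right inner_sum_right
      inner_congruence
    by (intro add_mono sum_mono order_refl Suc.IH) (use Suc.prems in auto)
  \<comment> \<open>The noise term \<open>mat 1\<close> contributes \<open>u \<bullet> u\<close>,
    which makes the form strictly positive; this is where invertibility of \<open>X (Suc k)\<close>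
    comes from.\<close>
  have pos: "0 < u \<bullet> (X (Suc k) *v u)" if "u \<noteq> 0" for u
  proof -
    have "0 < u \<bullet> u"
      using that by simp
    then show ?thesis
      unfolding X matrix_vector_mult_add_rdistrib sum_matrix_vector_mult inner_add_right inner_sum_right
        inner_congruence matrix_vector_mul_lid
      by (intro add_nonneg_pos add_nonneg_nonneg sum_nonneg psd)
  qed
  have psd_Suc: "pos_semidef (V (Suc k))"
    using feas Suc.prems by (simp add: sdp_feasible_def)
  then have sym: "transpose (X (Suc k)) = X (Suc k)"
    unfolding FV [symmetric] by (simp add: pos_semidef_def matrix_transpose_mul matrix_mul_assoc)
  obtain a b where v: "v = block_vec a b"
    by (rule block_vec_cases)
  have g: "transpose (vcat (mat 1) ?K) *v v = a + transpose ?K *v b"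
    unfolding v transpose_vcat_mult_block_vec by (simp add: transpose_mat)
  \<comment> \<open>The moment of state and input is generated from that of the state by the gain
    \<open>?K\<close>. Its form at \<open>(a, b)\<close> is thus the state form at
    \<open>a + transpose ?K *v b\<close>, ready for \<open>le\<close> and then the Schur
    bound.\<close>
  have "v \<bullet> (?S (Suc k) *v v) = (a + transpose ?K *v b) \<bullet> (second_moment P ?x *v (a + transpose ?K *v b))"
    unfolding state_input_sdp_controller [abs_def] second_moment_congruence [OF x, symmetric]
      inner_congruence g ..
  also have "\<dots> \<le> (a + transpose ?K *v b) \<bullet> (X (Suc k) *v (a + transpose ?K *v b))"
    by (rule le)
  also have "\<dots> \<le> v \<bullet> (V (Suc k) *v v)"
    unfolding v V [OF Suc.prems] using psd_Suc
    by (intro schur_gain_le pos sym) (simp_all add: V [OF Suc.prems])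
  finally show ?case .
qed

lemma control_cost_sdp_controller_le:
  assumes feas: "sdp_feasible N M A As B V"
    and V: "\<And>k. k < N \<Longrightarrow> V k = vcat (hcat (X k) (R k)) (hcat (transpose (R k)) (U k))"
  shows "control_cost P N M A As B C D w \<sigma> (sdp_controller X R) \<le> ennreal (sdp_cost N C D V)"
  unfolding control_cost_eq_sdp_cost [OF square_integrable_sdp_controller, where C = C and D = D] sdp_cost_def
  by (intro ennreal_leI mult_left_mono sum_mono trace_congruence_mono second_moment_sdp_controller_le [OF feas V])
     auto

end

theorem theorem2:
  fixes P :: "'a measure" and N M :: nat
    and A :: "real^'n^'n" and As :: "nat \<Rightarrow> real^'n^'n" and B :: "real^'m^'n"
    and C :: "real^'n^'p" and D :: "real^'m^'p"
    and w :: "nat \<Rightarrow> 'a \<Rightarrow> real^'n" and \<sigma> :: "nat \<Rightarrow> nat \<Rightarrow> 'a \<Rightarrow> real"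
    and V :: "nat \<Rightarrow> real^('n + 'm)^('n + 'm)"
    and X :: "nat \<Rightarrow> real^'n^'n" and R :: "nat \<Rightarrow> real^'m^'n" and U :: "nat \<Rightarrow> real^'m^'m"
  assumes "prob_space P"
    and "N > 0"
    and "pos_def (transpose (hcat C D) ** hcat C D)"
    and "white_noises P M w \<sigma>"
    and "\<And>k. k < N \<Longrightarrow> V k = vcat (hcat (X k) (R k)) (hcat (transpose (R k)) (U k))"
    and "is_arg_min (sdp_cost N C D) (sdp_feasible N M A As B) V"
  shows "is_arg_min (control_cost P N M A As B C D w \<sigma>) (causal N) (sdp_controller X R)"
proof -
  interpret prob_space P by fact
  interpret stochastic_system P M A As B w \<sigma>
    by unfold_locales fact
  \<comment> \<open>The optimal value of the program lies between the two costs: above that of the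
    constructed controller, below that of any causal one.\<close>
  have "control_cost P N M A As B C D w \<sigma> (sdp_controller X R) \<le> control_cost P N M A As B C D w \<sigma> \<mu>"
    if "causal N \<mu>" for \<mu>
  proof (rule order_trans)
    show "control_cost P N M A As B C D w \<sigma> (sdp_controller X R) \<le> ennreal (sdp_cost N C D V)"
    proof (rule control_cost_sdp_controller_le)
      show "sdp_feasible N M A As B V"
        using assms(6) by (simp add: is_arg_min_def)
    qed (rule assms(5))
    show "ennreal (sdp_cost N C D V) \<le> control_cost P N M A As B C D w \<sigma> \<mu>"
      by (rule sdp_cost_le_control_cost [OF that assms(2,3,6)])
  qed
  \<comment> \<open>\<open>is_arg_min\<close> asks that no causal controller be strictly cheaper,
    which the inequality gives in the linear order of \<open>ennreal\<close>.\<close>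
  then show ?thesis
    by (auto simp: is_arg_min_def causal_sdp_controller not_less)
qed

end
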